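(* Assume $m\geq 4$ and let $(a,b)\in\{(\pm\tfrac12,\pm\tfrac12)\}$. If $n\geq m^4$ and $\Delta_{n,m}^{(2)}\leq 3m(2\sqrt{3e}\,m)^{-m/2}$, then $$\Delta_{n,m}^{(1)}\leq 2\big(48\, m\log (1/\Delta_{n,m}^{(2)})\big)^{m/4}\Delta_{n,m}^{(2)}.$$ If $n\geq m^3$ and $\Delta_{n,m}^{(2)}\leq 2.5\,m(2\sqrt{5e}\,m)^{-m/2}$, then $$\Delta_{n,m}^{(1)}\leq 2\big(80\, m\log (1/\Delta_{n,m}^{(2)})\big)^{m/4}\Delta_{n,m}^{(2)}.$$
   Context: Standing setup. Let $n,m\geq1$ be integers and let $(a,b)\in\{-\tfrac12,\tfrac12\}^2$. Let $\rho_n^{a,b}$ be the probability density on $[0,\pi]^n$ given by $\rho_n^{--}(\theta)=\frac{2^{(n-1)^2}}{n!\pi^n}\prod_{j<k}(\cos\theta_j-\cos\theta_k)^2$, $\rho_n^{++}(\theta)=\frac{2^{n^2}}{n!\pi^n}\prod_{j}\sin^2\theta_j\prod_{j<k}(\cos\theta_j-\cos\theta_k)^2$, $\rho_n^{-+}(\theta)=\frac{2^{n^2}}{n!\pi^n}\prod_{j}\cos^2\frac{\theta_j}{2}\prod_{j<k}(\cos\theta_j-\cos\theta_k)^2$, $\rho_n^{+-}(\theta)=\frac{2^{n^2}}{n!\pi^n}\prod_{j}\sin^2\frac{\theta_j}{2}\prod_{j<k}(\cos\theta_j-\cos\theta_k)^2$. (These are the joint laws of the eigenangles of the non-deterministic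 eigenvalue pairs of Haar matrices in $SO(2n)$, $Sp(2n)$, $O(2n+1)^-$, $O(2n+1)^+$ respectively.) Write $\mathbb E^{a,b}$ for expectation under $\rho_n^{a,b}$, $\operatorname{Tr}U^k:=\sum_{j=1}^n 2\cos(k\theta_j)$, $X_k=\frac{1}{\sqrt k}(\operatorname{Tr}U^k-\mathbb E^{a,b}\operatorname{Tr}U^k)$, $\mathbf X=(X_1,\dots,X_m)$, $\mathscr P_{n,m}^{a,b}$ the density of $\mathbf X$, $\Psi_m(x)=(2\pi)^{-m/2}e^{-\|x\|^2/2}$, $\Delta_{n,m}^{(2)}=\|\mathscr P_{n,m}^{a,b}-\Psi_m\|_{L^2(\mathbb R^m)}$, $\Delta_{n,m}^{(1)}=\|\mathscr P_{n,m}^{a,b}-\Psi_m\|_{L^1(\mathbb R^m)}$. $\log$ is natural. *)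

theory Defs
  imports "HOL-Probability.Probability"
begin

text \<open>Eigenangle vectors theta are functions nat => real, with coordinates indexed by
  {..<n} (i.e. theta_1..theta_n are theta 0..theta (n-1)). The symmetry type (a,b)
  is given by two reals a, b, each in {-1/2, 1/2}.\<close>

definition angle_space :: "nat \<Rightarrow> (nat \<Rightarrow> real) measure" where
  "angle_space n = PiM {..<n} (\<lambda>_. lborel)"

definition vandermonde_sq :: "nat \<Rightarrow> (nat \<Rightarrow> real) \<Rightarrow> real" where
  "vandermonde_sq n \<theta> = (\<Prod>k<n. \<Prod>j<k. (cos (\<theta> j) - cos (\<theta> k))^2)"

definition rho :: "real \<Rightarrow> real \<Rightarrow> nat \<Rightarrow> (nat \<Rightarrow> real) \<Rightarrow> real" where
  "rho a b n \<theta> =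
     (if (\<forall>j<n. \<theta> j \<in> {0..pi}) then
        (if a = -1/2 \<and> b = -1/2 then
           2 ^ ((n - 1)^2) / (fact n * pi ^ n) * vandermonde_sq n \<theta>
         else if a = 1/2 \<and> b = 1/2 then
           2 ^ (n^2) / (fact n * pi ^ n) * (\<Prod>j<n. (sin (\<theta> j))^2) * vandermonde_sq n \<theta>
         else if a = -1/2 \<and> b = 1/2 then
           2 ^ (n^2) / (fact n * pi ^ n) * (\<Prod>j<n. (cos (\<theta> j / 2))^2) * vandermonde_sq n \<theta>
         else
           2 ^ (n^2) / (fact n * pi ^ n) * (\<Prod>j<n. (sin (\<theta> j / 2))^2) * vandermonde_sq n \<theta>)
      else 0)"

definition angle_law :: "real \<Rightarrow> real \<Rightarrow> nat \<Rightarrow> (nat \<Rightarrow> real) measure" where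
  "angle_law a b n = density (angle_space n) (\<lambda>\<theta>. ennreal (rho a b n \<theta>))"

definition trU :: "nat \<Rightarrow> nat \<Rightarrow> (nat \<Rightarrow> real) \<Rightarrow> real" where
  "trU n k \<theta> = (\<Sum>j<n. 2 * cos (real k * \<theta> j))"

definition meanTr :: "real \<Rightarrow> real \<Rightarrow> nat \<Rightarrow> nat \<Rightarrow> real" where
  "meanTr a b n k = (\<integral>\<theta>. trU n k \<theta> \<partial>angle_law a b n)"

definition Xvec :: "real \<Rightarrow> real \<Rightarrow> nat \<Rightarrow> nat \<Rightarrow> (nat \<Rightarrow> real) \<Rightarrow> (nat \<Rightarrow> real)" where
  "Xvec a b n m \<theta> = (\<lambda>k\<in>{1..m}. (trU n k \<theta> - meanTr a b n k) / sqrt (real k))"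

definition lebesgue_m :: "nat \<Rightarrow> (nat \<Rightarrow> real) measure" where
  "lebesgue_m m = PiM {1..m} (\<lambda>_. lborel)"

definition densX :: "real \<Rightarrow> real \<Rightarrow> nat \<Rightarrow> nat \<Rightarrow> (nat \<Rightarrow> real) \<Rightarrow> real" where
  "densX a b n m x =
     enn2real (RN_deriv (lebesgue_m m) (distr (angle_law a b n) (lebesgue_m m) (Xvec a b n m)) x)"

definition gaussm :: "nat \<Rightarrow> (nat \<Rightarrow> real) \<Rightarrow> real" where
  "gaussm m x = (2 * pi) powr (- real m / 2) * exp (- (\<Sum>k\<in>{1..m}. (x k)^2) / 2)"

definition Delta1 :: "real \<Rightarrow> real \<Rightarrow> nat \<Rightarrow> nat \<Rightarrow> ennreal" where
  "Delta1 a b n m = (\<integral>\<^sup>+ x. ennreal \<bar>densX a b n m x - gaussm m x\<bar> \<partial>lebesgue_m m)"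

definition Delta2 :: "real \<Rightarrow> real \<Rightarrow> nat \<Rightarrow> nat \<Rightarrow> ennreal" where
  "Delta2 a b n m =
     (let I = (\<integral>\<^sup>+ x. ennreal ((densX a b n m x - gaussm m x)^2) \<partial>lebesgue_m m)
      in if I = \<infinity> then \<infinity> else ennreal (sqrt (enn2real I)))"

end

(* With mass P \<le> 1 = mass G, the L1 distance of P from the Gaussian G is at most twice the
   integral of (G - P)^+.  On the cube [-R, R]^m this part is at most (2R)^(m/2) Delta2 by
   Cauchy-Schwarz, and outside the cube it is at most the Gaussian tail 2^(m/2) exp(-R^2/4).
   Taking R = 2 sqrt(log(1/Delta2)) makes the tail equal to 2^(m/2) Delta2, so no tail estimate
   for X is needed.  That rho has mass 1 follows from rho being a multiple of the squared
   determinant of the orthogonal functions cos((k + r/2) theta + phi), k < n. *)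

theory Submission
  imports Defs "Jordan_Normal_Form.Determinant"
begin

section \<open>Determinants of orthogonal functions\<close>

text \<open>Only an upper bound for the mass of P is established: \<open>densX\<close> is read off
  from \<open>RN_deriv\<close>, which is zero when the law of X has no density. This is why the
  comparison with G is one-sided. Both claims are instances of one bound, valid with any constant c
  >= 5 in place of 48 or 80. The smallness hypothesis enters through Delta2 <= 1/e, that is, L =
  log(1/Delta2) >= 1. The cube and the tail then contribute (16 L)^(m/4) Delta2 and 4^(m/4) Delta2.
  Superadditivity of t^(m/4), where m >= 4 enters, merges them into at most (20 L)^(m/4) Delta2, and
  20 L <= c m L. For the mass of rho, each function cos((k + r/2) theta + phi) is its k = 0 instance
  times a Chebyshev polynomial of degree k in cos theta. The k = 0 instance, squared, is the weight
  in rho; leading coefficients and norms account for the powers of 2 and pi.\<close>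

lemma poly_eq_smult_prod_roots:
  fixes p :: "'a::field poly"
  assumes "degree p \<le> n" and "inj_on x {..<n}" and "\<And>k. k < n \<Longrightarrow> poly p (x k) = 0"
  shows "p = Polynomial.smult (coeff p n) (\<Prod>k<n. [:- x k, 1:])"
proof -
  let ?q = "\<Prod>k<n. [:- x k, 1:]"
  \<comment> \<open>Subtracting the multiple of the monic product cancels the coefficient of degree
    n, so a nonzero r would have degree below n but n distinct roots.\<close>
  define r where "r = p - Polynomial.smult (coeff p n) ?q"
  have dq: "degree ?q = n"
    by (subst degree_prod_eq_sum_degree) auto
  have "lead_coeff ?q = 1"
    by (simp add: lead_coeff_prod)
  then have cr: "coeff r n = 0"
    unfolding r_def using dq by simp
  have dr: "degree r \<le> n"
    unfolding r_def using assms(1) dq by (intro degree_diff_le) (auto intro: order_trans[OF degree_smult_le])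
  have "r = 0"
  proof (rule ccontr)
    assume r0: "r \<noteq> 0"
    have "poly r (x k) = 0" if "k < n" for k
      using assms(3)[OF that] that by (auto simp: r_def poly_prod)
    then have "x ` {..<n} \<subseteq> {y. poly r y = 0}"
      by auto
    then have "card (x ` {..<n}) \<le> card {y. poly r y = 0}"
      by (rule card_mono[OF poly_roots_finite[OF r0]])
    then have "n \<le> card {y. poly r y = 0}"
      using assms(2) by (simp add: card_image)
    also have "\<dots> \<le> degree r"
      using card_poly_roots_bound[OF r0] .
    finally show False
      using dr cr r0 by (metis leading_coeff_0_iff order_antisym)
  qed
  then show ?thesis
    by (simp add: r_def)
qed

text \<open>Column operations remove all lower-order terms, so only the leading coefficients survive
  next to the Vandermonde product. With x i = cos theta_i this turns a determinant of Chebyshev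
  polynomials into the product of cosine differences in rho.\<close>

lemma det_polynomial_vandermonde:
  fixes P :: "nat \<Rightarrow> 'a::field poly"
  assumes deg: "\<And>j. j < n \<Longrightarrow> degree (P j) = j"
  shows "Determinant.det (mat n n (\<lambda>(i, j). poly (P j) (x i))) =
    (\<Prod>j<n. lead_coeff (P j)) * (\<Prod>k<n. \<Prod>j<k. (x k - x j))"
  using deg
proof (induction n)
  case 0
  then show ?case
    by (simp add: det_dim_zero)
next
  case (Suc n)
  define M where "M = (\<lambda>n y. mat n n (\<lambda>(i, j). poly (P j) (y i :: 'a)))"
  have IH: "Determinant.det (M n x) = (\<Prod>j<n. lead_coeff (P j)) * (\<Prod>k<n. \<Prod>j<k. (x k - x j))"
    unfolding M_def using Suc by simp
  \<comment> \<open>As a polynomial in the last point \<open>t\<close>, the determinant has degree at most \<open>n\<close>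
    and vanishes at the other \<open>n\<close> points.\<close>
  define y where "y = (\<lambda>t. x(n := t))"
  define c where "c = (\<lambda>j. cofactor (M (Suc n) x) n j)"
  \<comment> \<open>Row n is the only row containing t, and these cofactors delete it.\<close>
  have cof: "cofactor (M (Suc n) (y t)) n j = c j" if "j \<le> n" for t j
    unfolding c_def Determinant.cofactor_def M_def y_def mat_delete_def
    using that by (intro arg_cong2[where f = times] arg_cong[where f = Determinant.det] refl eq_matI) auto
  have cn: "c n = Determinant.det (M n x)"
    unfolding c_def Determinant.cofactor_def M_def mat_delete_def
    by (simp, intro arg_cong[where f = Determinant.det] eq_matI) auto
  define Q where "Q = (\<Sum>j\<le>n. Polynomial.smult (c j) (P j))"
  have Q: "Determinant.det (M (Suc n) (y t)) = poly Q t" for t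
  proof -
    have "Determinant.det (M (Suc n) (y t)) =
        (\<Sum>j<Suc n. M (Suc n) (y t) $$ (n, j) * cofactor (M (Suc n) (y t)) n j)"
      by (rule laplace_expansion_row) (auto simp: M_def)
    also have "\<dots> = (\<Sum>j\<le>n. poly (P j) t * c j)"
      unfolding lessThan_Suc_atMost
      by (intro sum.cong refl) (simp add: cof, simp add: M_def y_def)
    finally show ?thesis
      by (simp add: Q_def poly_sum mult.commute)
  qed
  have Qx: "Determinant.det (M (Suc n) x) = poly Q (x n)"
    using Q[of "x n"] by (simp add: y_def)
  have roots: "poly Q (x k) = 0" if "k < n" for k
    unfolding Q[symmetric]
    by (rule det_identical_rows[of _ "Suc n" k n])
      (use that in \<open>auto simp: M_def y_def intro!: eq_vecI\<close>)
  have dQ: "degree Q \<le> n"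
    unfolding Q_def using Suc.prems
    by (intro degree_sum_le) (auto intro: order_trans[OF degree_smult_le])
  have coQ: "coeff Q n = c n * lead_coeff (P n)"
  proof -
    have "coeff Q n = (\<Sum>j\<le>n. if j = n then c n * coeff (P n) n else 0)"
      unfolding Q_def coeff_sum using Suc.prems by (intro sum.cong refl) (auto simp: coeff_eq_0)
    then show ?thesis
      using Suc.prems[of n] by simp
  qed
  show ?case
  proof (cases "inj_on x {..<n}")
    case True
    have "poly Q (x n) = coeff Q n * (\<Prod>k<n. (x n - x k))"
      by (subst poly_eq_smult_prod_roots[OF dQ True roots]) (auto simp: poly_prod)
    then show ?thesis
      using Qx coQ cn IH by (simp add: M_def mult_ac)
  next
    \<comment> \<open>If earlier points coincide, there are too few distinct roots to factor Q, but
      both sides vanish: two rows agree and one difference is zero.\<close>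
    case False
    then obtain i j where ij: "i < n" "j < n" "i \<noteq> j" "x i = x j"
      by (auto simp: inj_on_def)
    have "Determinant.det (M (Suc n) x) = 0"
      by (rule det_identical_rows[of _ "Suc n" i j])
        (use ij in \<open>auto simp: M_def intro!: eq_vecI\<close>)
    moreover have "(\<Prod>k<Suc n. \<Prod>j<k. (x k - x j)) = 0"
    proof -
      define a b where "a = min i j" and "b = max i j"
      have "a < b" "b < Suc n" "x b - x a = 0"
        using ij by (auto simp: a_def b_def min_def max_def)
      then have "(\<Prod>j<b. (x b - x j)) = 0" and "b \<in> {..<Suc n}"
        by (auto intro: prod_zero bexI[of _ a])
      then show ?thesis
        by (intro prod_zero) blast+
    qed
    ultimately show ?thesis
      by (simp add: M_def)
  qed
qed

text \<open>Expand both determinants by the Leibniz formula. Each pair of permutations (p, q) gives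
  a product of one-dimensional integrals; if p and q differ at some i, orthogonality makes that
  factor zero. The n! diagonal pairs have squared sign 1 and each contribute the product of the h
  j.\<close>

lemma
  fixes g :: "nat \<Rightarrow> 'a \<Rightarrow> real"
  assumes "sigma_finite_measure M"
    and int: "\<And>i j. i < n \<Longrightarrow> j < n \<Longrightarrow> integrable M (\<lambda>x. g i x * g j x)"
    and orth: "\<And>i j. i < n \<Longrightarrow> j < n \<Longrightarrow> (\<integral>x. g i x * g j x \<partial>M) = (if i = j then h i else 0)"
  shows integrable_det_orthogonal_sq:
      "integrable (Pi\<^sub>M {..<n} (\<lambda>_. M)) (\<lambda>x. (Determinant.det (mat n n (\<lambda>(i, j). g j (x i))))\<^sup>2)"
    and integral_det_orthogonal_sq:
      "(\<integral>x. (Determinant.det (mat n n (\<lambda>(i, j). g j (x i))))\<^sup>2 \<partial>Pi\<^sub>M {..<n} (\<lambda>_. M)) = fact n * (\<Prod>j<n. h j)"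
proof -
  interpret product_sigma_finite "\<lambda>_::nat. M"
    using assms(1) by unfold_locales (auto simp: sigma_finite_measure_def)
  let ?S = "{p. p permutes {..<n}}"
  have sq: "(Determinant.det (mat n n (\<lambda>(i, j). g j (x i))))\<^sup>2 =
      (\<Sum>p\<in>?S. \<Sum>q\<in>?S. signof p * signof q * (\<Prod>i<n. g (p i) (x i) * g (q i) (x i)))" for x
  proof -
    have "Determinant.det (mat n n (\<lambda>(i, j). g j (x i))) = (\<Sum>p\<in>?S. signof p * (\<Prod>i<n. g (p i) (x i)))"
      by (subst det_def'[of _ n])
        (auto simp: atLeast0LessThan dest: permutes_in_image intro!: sum.cong prod.cong)
    then show ?thesis
      by (simp add: power2_eq_square sum_product prod.distrib mult_ac)
  qed
  have lt: "p i < n" if "p \<in> ?S" "i < n" for p i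
    using that permutes_in_image[of p "{..<n}" i] by auto
  have I: "integrable (Pi\<^sub>M {..<n} (\<lambda>_. M)) (\<lambda>x. \<Prod>i<n. g (p i) (x i) * g (q i) (x i))"
    if "p \<in> ?S" "q \<in> ?S" for p q
    using that lt by (intro product_integrable_prod int) auto
  then show "integrable (Pi\<^sub>M {..<n} (\<lambda>_. M)) (\<lambda>x. (Determinant.det (mat n n (\<lambda>(i, j). g j (x i))))\<^sup>2)"
    unfolding sq by (intro Bochner_Integration.integrable_sum integrable_mult_right)
  have J: "(\<integral>x. (\<Prod>i<n. g (p i) (x i) * g (q i) (x i)) \<partial>Pi\<^sub>M {..<n} (\<lambda>_. M)) =
      (if p = q then (\<Prod>j<n. h j) else 0)" if pq: "p \<in> ?S" "q \<in> ?S" for p q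
  proof -
    have *: "(\<integral>x. (\<Prod>i<n. g (p i) (x i) * g (q i) (x i)) \<partial>Pi\<^sub>M {..<n} (\<lambda>_. M)) =
        (\<Prod>i<n. if p i = q i then h (p i) else 0)"
      using pq by (subst product_integral_prod) (auto intro!: prod.cong int simp: orth lt)
    show ?thesis
    proof (cases "p = q")
      case True
      then show ?thesis
        unfolding * using pq prod.permute[of p "{..<n}" h] by (simp add: comp_def)
    next
      case False
      then obtain i where "p i \<noteq> q i"
        by auto
      moreover from this have "i < n"
        using pq by (metis lessThan_iff mem_Collect_eq permutes_def)
      ultimately have "\<exists>i\<in>{..<n}. (if p i = q i then h (p i) else 0) = 0"
        by auto
      then show ?thesis
        unfolding * using False by (simp add: prod_zero_iff del: if_split)
    qed
  qed
  have "(\<integral>x. (Determinant.det (mat n n (\<lambda>(i, j). g j (x i))))\<^sup>2 \<partial>Pi\<^sub>M {..<n} (\<lambda>_. M)) =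
      (\<Sum>p\<in>?S. \<Sum>q\<in>?S. signof p * signof q * (if p = q then (\<Prod>j<n. h j) else 0))"
    unfolding sq using I
    by (subst Bochner_Integration.integral_sum; (intro Bochner_Integration.integrable_sum integrable_mult_right)?; (simp; fail)?)
      (auto intro!: sum.cong simp: J Bochner_Integration.integral_sum simp del: of_int_mult)
  also have "\<dots> = (\<Sum>p\<in>?S. signof p * signof p * (\<Prod>j<n. h j))"
    by (intro sum.cong refl) (simp add: if_distrib sum.delta finite_permutations cong: if_cong)
  also have "\<dots> = (\<Sum>p\<in>?S. (\<Prod>j<n. h j))"
    by (intro sum.cong refl) (simp add: sign_def)
  also have "\<dots> = fact n * (\<Prod>j<n. h j)"
    by (simp add: card_permutations)
  finally show "(\<integral>x. (Determinant.det (mat n n (\<lambda>(i, j). g j (x i))))\<^sup>2 \<partial>Pi\<^sub>M {..<n} (\<lambda>_. M)) = fact n * (\<Prod>j<n. h j)" .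
qed

lemma det_scale_rows:
  fixes w :: "nat \<Rightarrow> 'a::comm_ring_1"
  shows "Determinant.det (mat n n (\<lambda>(i, j). w i * f i j)) =
    (\<Prod>i<n. w i) * Determinant.det (mat n n (\<lambda>(i, j). f i j))"
proof -
  have "(\<Prod>i = 0..<n. mat n n (\<lambda>(i, j). w i * f i j) $$ (i, p i)) =
      (\<Prod>i<n. w i) * (\<Prod>i = 0..<n. mat n n (\<lambda>(i, j). f i j) $$ (i, p i))" if "p permutes {0..<n}" for p
    using permutes_in_image[OF that]
    by (simp add: prod.distrib[symmetric] atLeast0LessThan)
  then show ?thesis
    by (simp add: det_def'[of _ n] sum_distrib_left mult_ac)
qed

section \<open>The total mass of the eigenangle density\<close>

text \<open>With \<open>(d, e)\<close> equal to \<open>(1, 0)\<close>, \<open>(2, 0)\<close>, \<open>(2, -1)\<close>, \<open>(2, 1)\<close> these are the Chebyshev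
  polynomials of the first, second, third and fourth kind.\<close>

fun chebyshev :: "real \<Rightarrow> real \<Rightarrow> nat \<Rightarrow> real poly" where
  "chebyshev d e 0 = 1"
| "chebyshev d e (Suc 0) = [:e, d:]"
| "chebyshev d e (Suc (Suc k)) = [:0, 2:] * chebyshev d e (Suc k) - chebyshev d e k"

text \<open>A degree bound paired with one coefficient passes through the recursion even for d = 0;
  the exact degree follows once d is nonzero.\<close>

lemma chebyshev_coeffs:
  "degree (chebyshev d e k) \<le> k \<and> coeff (chebyshev d e k) k = (if k = 0 then 1 else d * 2 ^ (k - 1))"
proof (induction d e k rule: chebyshev.induct)
  case (3 d e k)
  have "degree ([:0, 2:] * chebyshev d e (Suc k)) \<le> Suc (Suc k)"
    using degree_mult_le[of "[:0, 2:]" "chebyshev d e (Suc k)"] 3 by simp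
  moreover have "coeff (chebyshev d e k) (Suc (Suc k)) = 0"
    using 3 by (intro coeff_eq_0) simp
  ultimately show ?case
    using 3 by (auto intro!: degree_diff_le)
qed auto

lemma
  assumes "d \<noteq> 0"
  shows degree_chebyshev: "degree (chebyshev d e k) = k"
    and lead_coeff_chebyshev: "lead_coeff (chebyshev d e k) = (if k = 0 then 1 else d * 2 ^ (k - 1))"
proof -
  have "coeff (chebyshev d e k) k \<noteq> 0"
    using chebyshev_coeffs[of d e k] assms by simp
  then show *: "degree (chebyshev d e k) = k"
    using chebyshev_coeffs[of d e k] le_degree by (metis order_antisym)
  show "lead_coeff (chebyshev d e k) = (if k = 0 then 1 else d * 2 ^ (k - 1))"
    using chebyshev_coeffs[of d e k] unfolding * by simp
qed

text \<open>Both sides obey the same three-term recurrence. Keeping f 0 as a factor instead of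
  dividing by it allows the weight to vanish at some angles.\<close>

lemma poly_chebyshev:
  assumes "f (Suc 0) = (d * c + e) * f 0" and "\<And>k. f (Suc (Suc k)) = 2 * c * f (Suc k) - f k"
  shows "f k = f 0 * poly (chebyshev d e k) c"
  using assms by (induction d e k rule: chebyshev.induct) (simp_all add: right_diff_distrib mult_ac)

text \<open>The interval is only half a period, so the boundary terms need not cancel each other.
  The condition on the phase makes each of them vanish, since sin(N pi) = 0.\<close>

lemma has_bochner_integral_cos_period:
  fixes N :: int
  assumes "sin \<psi> = 0"
  shows "has_bochner_integral lborel (\<lambda>\<theta>. cos (of_int N * \<theta> + \<psi>) * indicator {0..pi} \<theta>)
    (if N = 0 then pi * cos \<psi> else 0)"
proof (cases "N = 0")
  case True
  have "has_bochner_integral lborel (\<lambda>\<theta>. cos \<psi> * indicator {0..pi} \<theta>) (cos \<psi> * pi - cos \<psi> * 0)"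
    by (rule has_bochner_integral_FTC_Icc_real) (auto intro!: derivative_eq_intros)
  with True show ?thesis
    by (simp add: mult.commute)
next
  case False
  have "has_bochner_integral lborel (\<lambda>\<theta>. cos (of_int N * \<theta> + \<psi>) * indicator {0..pi} \<theta>)
      (sin (of_int N * pi + \<psi>) / of_int N - sin (of_int N * 0 + \<psi>) / of_int N)"
    by (rule has_bochner_integral_FTC_Icc_real) (use False in \<open>auto intro!: derivative_eq_intros\<close>)
  moreover have "sin (of_int N * pi) = 0"
    using sin_zero_iff_int2 by blast
  ultimately show ?thesis
    using False assms by (simp add: sin_add)
qed

text \<open>The product splits into half the sum of cosines with frequencies j - k and j + k + r,
  the latter with phase 2 phi. The second frequency is zero only for r = j = k = 0; there phi = 0,
  which gives the exceptional norm pi.\<close>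

lemma has_bochner_integral_cos_orthogonal:
  fixes r j k :: nat
  assumes "sin (2 * \<phi>) = 0" and "r = 0 \<Longrightarrow> \<phi> = 0"
  shows "has_bochner_integral lborel
    (\<lambda>\<theta>. (indicator {0..pi} \<theta> * cos ((j + r / 2) * \<theta> + \<phi>)) * (indicator {0..pi} \<theta> * cos ((k + r / 2) * \<theta> + \<phi>)))
    (if j = k then (if r = 0 \<and> j = 0 then pi else pi / 2) else 0)"
proof -
  define N where "N = int j - int k"
  define N' where "N' = int j + int k + int r"
  have "has_bochner_integral lborel (\<lambda>\<theta>.
      (cos (of_int N * \<theta> + 0) * indicator {0..pi} \<theta> + cos (of_int N' * \<theta> + 2 * \<phi>) * indicator {0..pi} \<theta>) / 2)
      (((if N = 0 then pi * cos 0 else 0) + (if N' = 0 then pi * cos (2 * \<phi>) else 0)) / 2)"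
    using assms
    by (intro has_bochner_integral_divide_zero has_bochner_integral_add has_bochner_integral_cos_period) auto
  also have "((if N = 0 then pi * cos 0 else 0) + (if N' = 0 then pi * cos (2 * \<phi>) else 0)) / 2 =
      (if j = k then (if r = 0 \<and> j = 0 then pi else pi / 2) else 0)"
    using assms(2) by (auto simp: N_def N'_def)
  also have "(\<lambda>\<theta>. (cos (of_int N * \<theta> + 0) * indicator {0..pi} \<theta>
        + cos (of_int N' * \<theta> + 2 * \<phi>) * indicator {0..pi} \<theta>) / 2) =
      (\<lambda>\<theta>. (indicator {0..pi} \<theta> * cos ((j + r / 2) * \<theta> + \<phi>)) * (indicator {0..pi} \<theta> * cos ((k + r / 2) * \<theta> + \<phi>)))"
  proof
    fix \<theta>
    have "cos ((j + r / 2) * \<theta> + \<phi>) * cos ((k + r / 2) * \<theta> + \<phi>) =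
        (cos (of_int N * \<theta> + 0) + cos (of_int N' * \<theta> + 2 * \<phi>)) / 2"
      unfolding cos_times_cos by (simp add: N_def N'_def algebra_simps)
    then show "(cos (of_int N * \<theta> + 0) * indicator {0..pi} \<theta> + cos (of_int N' * \<theta> + 2 * \<phi>) * indicator {0..pi} \<theta>) / 2 =
        (indicator {0..pi} \<theta> * cos ((j + r / 2) * \<theta> + \<phi>)) * (indicator {0..pi} \<theta> * cos ((k + r / 2) * \<theta> + \<phi>))"
      by (auto simp: indicator_def)
  qed
  finally show ?thesis .
qed

text \<open>The pairs (r, phi) = (0, 0), (2, -pi/2), (1, 0), (1, -pi/2) give the weights 1, sin^2
  theta, cos^2(theta/2), sin^2(theta/2) of the four cases. Assumption \<open>C\<close> says that C
  is the squared product of leading coefficients divided by the integral of the squared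
  determinant.\<close>

lemma nn_integral_cos_vandermonde_sq:
  fixes r n :: nat and d e \<phi> :: real
  assumes d: "d \<noteq> 0" and \<phi>: "sin (2 * \<phi>) = 0" "r = 0 \<Longrightarrow> \<phi> = 0"
    and f1: "\<And>\<theta>. cos ((1 + r / 2) * \<theta> + \<phi>) = (d * cos \<theta> + e) * cos (r / 2 * \<theta> + \<phi>)"
    and C: "C * (fact n * (\<Prod>j<n. if r = 0 \<and> j = 0 then pi else pi / 2)) =
      (\<Prod>j<n. if j = 0 then 1 else d * 2 ^ (j - 1))\<^sup>2"
  shows "(\<integral>\<^sup>+\<theta>. ennreal (if \<forall>j<n. \<theta> j \<in> {0..pi}
      then C * (\<Prod>j<n. (cos (r / 2 * \<theta> j + \<phi>))\<^sup>2) * vandermonde_sq n \<theta> else 0) \<partial>angle_space n) = 1"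
proof -
  \<comment> \<open>With the indicator inside g, an angle outside [0, pi] gives a zero row, so the
    support condition of rho is built into the determinant.\<close>
  define g :: "nat \<Rightarrow> real \<Rightarrow> real" where
    "g = (\<lambda>k \<theta>. indicator {0..pi} \<theta> * cos ((k + r / 2) * \<theta> + \<phi>))"
  define D where "D = (\<lambda>\<theta>. Determinant.det (mat n n (\<lambda>(i, j). g j (\<theta> i))))"
  let ?l = "\<Prod>j<n. if j = 0 then 1 else d * 2 ^ (j - 1)"
  let ?h = "\<lambda>j. if r = 0 \<and> j = 0 then pi else pi / 2"
  have g: "g k \<theta> = (indicator {0..pi} \<theta> * cos (r / 2 * \<theta> + \<phi>)) * poly (chebyshev d e k) (cos \<theta>)" for k \<theta>
  proof -
    have "cos ((k + r / 2) * \<theta> + \<phi>) = cos ((0 + r / 2) * \<theta> + \<phi>) * poly (chebyshev d e k) (cos \<theta>)"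
    proof (rule poly_chebyshev[where f = "\<lambda>k::nat. cos ((k + r / 2) * \<theta> + \<phi>)", simplified of_nat_0])
      fix k
      have *: "(Suc (Suc k) + r / 2) * \<theta> + \<phi> = ((Suc k + r / 2) * \<theta> + \<phi>) + \<theta>"
        "(k + r / 2) * \<theta> + \<phi> = ((Suc k + r / 2) * \<theta> + \<phi>) - \<theta>"
        by (simp_all add: algebra_simps)
      show "cos ((Suc (Suc k) + r / 2) * \<theta> + \<phi>) =
          2 * cos \<theta> * cos ((Suc k + r / 2) * \<theta> + \<phi>) - cos ((k + r / 2) * \<theta> + \<phi>)"
        unfolding * cos_add cos_diff by simp
    qed (simp add: f1)
    then show ?thesis
      by (simp add: g_def)
  qed
  have D: "(D \<theta>)\<^sup>2 = (if \<forall>j<n. \<theta> j \<in> {0..pi}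
      then ?l\<^sup>2 * (\<Prod>j<n. (cos (r / 2 * \<theta> j + \<phi>))\<^sup>2) * vandermonde_sq n \<theta> else 0)" for \<theta>
  proof -
    define Q where "Q \<longleftrightarrow> (\<forall>j<n. \<theta> j \<in> {0..pi})"
    have "D \<theta> = (\<Prod>j<n. indicator {0..pi} (\<theta> j) * cos (r / 2 * \<theta> j + \<phi>)) *
        (?l * (\<Prod>k<n. \<Prod>j<k. (cos (\<theta> k) - cos (\<theta> j))))"
      unfolding D_def g det_scale_rows
      by (subst det_polynomial_vandermonde[where x = "\<lambda>i. cos (\<theta> i)"])
        (simp_all add: degree_chebyshev[OF d] lead_coeff_chebyshev[OF d, unfolded degree_chebyshev[OF d]])
    moreover have "(\<Prod>j<n. indicator {0..pi} (\<theta> j) * cos (r / 2 * \<theta> j + \<phi>))\<^sup>2 =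
        (if Q then \<Prod>j<n. (cos (r / 2 * \<theta> j + \<phi>))\<^sup>2 else 0)"
      unfolding prod_power_distrib Q_def
      by (cases "\<forall>j<n. \<theta> j \<in> {0..pi}") (auto intro: prod.cong bexI simp: indicator_def)
    moreover have "vandermonde_sq n \<theta> = (\<Prod>k<n. \<Prod>j<k. (cos (\<theta> k) - cos (\<theta> j)))\<^sup>2"
      unfolding vandermonde_sq_def prod_power_distrib by (intro prod.cong refl power2_commute)
    ultimately show ?thesis
      unfolding Q_def[symmetric]
      by (cases Q) (simp_all only: power_mult_distrib if_True if_False mult_ac mult_zero_left mult_zero_right)
  qed
  have int: "integrable lborel (\<lambda>\<theta>. g j \<theta> * g k \<theta>)"
    and orth: "(\<integral>\<theta>. g j \<theta> * g k \<theta> \<partial>lborel) = (if j = k then ?h j else 0)" for j k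
    using has_bochner_integral_cos_orthogonal[OF \<phi>, where j = j and k = k] unfolding g_def
    by (auto simp only: has_bochner_integral_iff)
  have sf: "sigma_finite_measure (lborel :: real measure)"
    by unfold_locales
  define H where "H = fact n * (\<Prod>j<n. ?h j)"
  have H: "0 < H"
    unfolding H_def by (intro mult_pos_pos prod_pos) auto
  \<comment> \<open>Writing C as C * H / H exposes the product that assumption \<open>C\<close>
    identifies with the squared leading coefficients.\<close>
  then have *: "(if P then C * x * y else 0) = (if P then C * H * x * y else 0) / H" for P x y
    by simp
  have "(\<integral>\<^sup>+\<theta>. ennreal (if \<forall>j<n. \<theta> j \<in> {0..pi}
      then C * (\<Prod>j<n. (cos (r / 2 * \<theta> j + \<phi>))\<^sup>2) * vandermonde_sq n \<theta> else 0) \<partial>angle_space n) =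
      (\<integral>\<^sup>+\<theta>. ennreal ((D \<theta>)\<^sup>2 / H) \<partial>angle_space n)"
    unfolding D C[folded H_def, symmetric] by (simp only: *)
  also have "\<dots> = ennreal (\<integral>\<theta>. (D \<theta>)\<^sup>2 / H \<partial>angle_space n)"
    unfolding angle_space_def D_def using H integrable_det_orthogonal_sq[OF sf int orth]
    by (intro nn_integral_eq_integral integrable_divide_zero) auto
  also have "(\<integral>\<theta>. (D \<theta>)\<^sup>2 / H \<partial>angle_space n) = 1"
    using integral_det_orthogonal_sq[OF sf int orth, of n] H
    by (simp add: angle_space_def D_def H_def)
  finally show ?thesis
    by simp
qed

text \<open>The exponents satisfy 2 (0 + ... + (n - 1)) + n = n^2; the extra 2^n comes from the
  norms pi/2.\<close>

lemma prod_two_power_sq: "(\<Prod>j<n. (2::real) ^ j)\<^sup>2 * 2 ^ n = 2 ^ (n\<^sup>2)"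
  by (induction n) (auto simp: power_mult_distrib power_add power2_eq_square algebra_simps)

lemma nn_integral_rho:
  assumes "a \<in> {-1/2, 1/2}" and "b \<in> {-1/2, 1/2}"
  shows "(\<integral>\<^sup>+\<theta>. ennreal (rho a b n \<theta>) \<partial>angle_space n) = 1"
proof -
  let ?C = "2 ^ (n\<^sup>2) / (fact n * pi ^ n) :: real"
  have C: "?C * (fact n * (\<Prod>j<n. if r = 0 \<and> j = 0 then pi else pi / 2)) =
      (\<Prod>j<n. if j = 0 then 1 else 2 * 2 ^ (j - 1))\<^sup>2" if "0 < r" for r :: nat
  proof -
    have "(\<Prod>j<n. if j = 0 then 1 else 2 * 2 ^ (j - 1)) = (\<Prod>j<n. (2::real) ^ j)"
      by (intro prod.cong) (auto simp: power_Suc[symmetric] simp del: power_Suc)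
    then show ?thesis
      using that prod_two_power_sq[of n] by (simp add: power_divide field_simps)
  qed
  \<comment> \<open>The reflected term cos((s - 1) theta + phi) determines e: it is zero for sin
    theta, equals the weight function for cos(theta/2), and is its negative for sin(theta/2), giving
    e = 0, -1, 1.\<close>
  have sums: "cos ((1 + s) * \<theta> + \<phi>) = 2 * cos \<theta> * cos (s * \<theta> + \<phi>) - cos (s * \<theta> + \<phi> - \<theta>)" for s \<theta> \<phi> :: real
  proof -
    have "(1 + s) * \<theta> + \<phi> = (s * \<theta> + \<phi>) + \<theta>"
      by (simp add: algebra_simps)
    then show ?thesis
      by (simp only: cos_add[of _ \<theta>] cos_diff[of _ \<theta>]) simp
  qed
  consider "a = -1/2" "b = -1/2" | "a = 1/2" "b = 1/2" | "a = -1/2" "b = 1/2" | "a = 1/2" "b = -1/2"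
    using assms by auto
  then show ?thesis
  proof cases
    case 1
    let ?K = "2 ^ ((n - 1)\<^sup>2) / (fact n * pi ^ n) :: real"
    \<comment> \<open>The constant function has norm pi instead of pi/2, and the leading
      coefficients are 1, 1, 2, 4, ...; both shift the exponent from n^2 to (n - 1)^2.\<close>
    have K: "?K * (fact n * (\<Prod>j<n. if (0::nat) = 0 \<and> j = 0 then pi else pi / 2)) =
        (\<Prod>j<n. if j = 0 then 1 else 1 * 2 ^ (j - 1))\<^sup>2"
    proof (cases n)
      case (Suc k)
      then show ?thesis
        using prod_two_power_sq[of k]
        by (simp add: prod.lessThan_Suc_shift power_divide field_simps del: prod.lessThan_Suc fact_Suc)
    qed simp
    have rho: "rho a b n \<theta> = (if \<forall>j<n. \<theta> j \<in> {0..pi}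
        then ?K * (\<Prod>j<n. (cos (real 0 / 2 * \<theta> j + 0))\<^sup>2) * vandermonde_sq n \<theta> else 0)" for \<theta>
      using 1 by (simp add: rho_def cong: if_cong)
    show ?thesis
      unfolding rho by (rule nn_integral_cos_vandermonde_sq[where d = 1 and e = 0]) (simp_all only: K, simp_all)
  next
    case 2
    have f1: "cos ((1 + real 2 / 2) * \<theta> + - (pi / 2)) = (2 * cos \<theta> + 0) * cos (real 2 / 2 * \<theta> + - (pi / 2))" for \<theta>
      unfolding sums by simp
    have rho: "rho a b n \<theta> = (if \<forall>j<n. \<theta> j \<in> {0..pi}
        then ?C * (\<Prod>j<n. (cos (real 2 / 2 * \<theta> j + - (pi / 2)))\<^sup>2) * vandermonde_sq n \<theta> else 0)" for \<theta>
      using 2 by (simp add: rho_def cos_diff cong: if_cong)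
    show ?thesis
      unfolding rho by (rule nn_integral_cos_vandermonde_sq[OF _ _ _ f1 C]) simp_all
  next
    case 3
    have f1: "cos ((1 + real 1 / 2) * \<theta> + 0) = (2 * cos \<theta> + - 1) * cos (real 1 / 2 * \<theta> + 0)" for \<theta>
    proof -
      have "\<theta> / 2 - \<theta> = - (\<theta> / 2)"
        by simp
      then have "cos (\<theta> / 2 - \<theta>) = cos (\<theta> / 2)"
        by (simp only: cos_minus)
      then show ?thesis
        unfolding sums by (simp add: algebra_simps)
    qed
    have rho: "rho a b n \<theta> = (if \<forall>j<n. \<theta> j \<in> {0..pi}
        then ?C * (\<Prod>j<n. (cos (real 1 / 2 * \<theta> j + 0))\<^sup>2) * vandermonde_sq n \<theta> else 0)" for \<theta>
      using 3 by (simp add: rho_def cong: if_cong)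
    show ?thesis
      unfolding rho by (rule nn_integral_cos_vandermonde_sq[OF _ _ _ f1 C]) simp_all
  next
    case 4
    have f1: "cos ((1 + real 1 / 2) * \<theta> + - (pi / 2)) = (2 * cos \<theta> + 1) * cos (real 1 / 2 * \<theta> + - (pi / 2))" for \<theta>
    proof -
      have eq: "real 1 / 2 * \<theta> + - (pi / 2) - \<theta> = - (pi / 2 + \<theta> / 2)"
        by (simp add: field_simps)
      have "cos (real 1 / 2 * \<theta> + - (pi / 2) - \<theta>) = - cos (real 1 / 2 * \<theta> + - (pi / 2))"
        unfolding eq cos_minus by (simp add: cos_add cos_diff)
      then show ?thesis
        unfolding sums by (simp only: distrib_right diff_minus_eq_add mult_1)
    qed
    have rho: "rho a b n \<theta> = (if \<forall>j<n. \<theta> j \<in> {0..pi}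
        then ?C * (\<Prod>j<n. (cos (real 1 / 2 * \<theta> j + - (pi / 2)))\<^sup>2) * vandermonde_sq n \<theta> else 0)" for \<theta>
      using 4 by (simp add: rho_def cos_diff cong: if_cong)
    show ?thesis
      unfolding rho by (rule nn_integral_cos_vandermonde_sq[OF _ _ _ f1 C]) simp_all
  qed
qed

section \<open>The law of X and the mass of its density\<close>

lemma rho_measurable [measurable]: "rho a b n \<in> borel_measurable (angle_space n)"
  unfolding rho_def[abs_def] angle_space_def vandermonde_sq_def by measurable

lemma emeasure_angle_law:
  assumes "a \<in> {-1/2, 1/2}" and "b \<in> {-1/2, 1/2}"
  shows "emeasure (angle_law a b n) (space (angle_law a b n)) = 1"
  using nn_integral_rho[OF assms, of n] by (simp add: angle_law_def emeasure_density)

lemma Xvec_measurable [measurable]: "Xvec a b n m \<in> measurable (angle_law a b n) (lebesgue_m m)"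
  unfolding Xvec_def[abs_def] lebesgue_m_def angle_law_def angle_space_def trU_def by measurable

lemma nn_integral_densX_le_1:
  assumes "a \<in> {-1/2, 1/2}" and "b \<in> {-1/2, 1/2}"
  shows "(\<integral>\<^sup>+x. ennreal (densX a b n m x) \<partial>lebesgue_m m) \<le> 1"
proof -
  let ?M = "lebesgue_m m" and ?N = "distr (angle_law a b n) (lebesgue_m m) (Xvec a b n m)"
  have "(\<integral>\<^sup>+x. RN_deriv ?M ?N x \<partial>?M) \<le> 1"
  proof (cases "\<exists>f. f \<in> borel_measurable ?M \<and> density ?M f = ?N")
    case True
    then have dens: "density ?M (RN_deriv ?M ?N) = ?N"
      using RN_derivI by blast
    have "(\<integral>\<^sup>+x. RN_deriv ?M ?N x \<partial>?M) = emeasure (density ?M (RN_deriv ?M ?N)) (space ?M)"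
      by (simp add: emeasure_density)
    also have "\<dots> = emeasure (angle_law a b n) (Xvec a b n m -` space ?M \<inter> space (angle_law a b n))"
      unfolding dens by (rule emeasure_distr) measurable
    also have "\<dots> \<le> emeasure (angle_law a b n) (space (angle_law a b n))"
      by (intro emeasure_mono) auto
    finally show ?thesis
      using emeasure_angle_law[OF assms] by simp
  next
    \<comment> \<open>If the law of \<open>X\<close> has no density, \<open>RN_deriv\<close> is the zero function.\<close>
    case False
    then have "RN_deriv ?M ?N = (\<lambda>_. 0)"
      unfolding RN_deriv_def by (simp only: if_False)
    then show ?thesis
      by simp
  qed
  \<comment> \<open>\<open>enn2real\<close> sends infinity to 0, so passing to a real-valued density
    can only lose mass.\<close>
  moreover have "ennreal (enn2real y) \<le> y" for y
    by (cases y) auto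
  then have "(\<integral>\<^sup>+x. ennreal (densX a b n m x) \<partial>?M) \<le> (\<integral>\<^sup>+x. RN_deriv ?M ?N x \<partial>?M)"
    unfolding densX_def by (intro nn_integral_mono)
  ultimately show ?thesis
    by (rule order_trans[rotated])
qed

section \<open>Comparison with the Gaussian density\<close>

text \<open>Pointwise, G + |P - G| = P + 2 (G - P)^+. Integrating and cancelling the finite mass 1
  gives the bound; the additive form avoids truncated subtraction in \<open>ennreal\<close>.\<close>

lemma nn_integral_abs_diff_le_pos_part:
  fixes P G :: "'a \<Rightarrow> real"
  assumes [measurable]: "P \<in> borel_measurable M" "G \<in> borel_measurable M"
    and P0: "\<And>x. 0 \<le> P x" and G0: "\<And>x. 0 \<le> G x"
    and P1: "(\<integral>\<^sup>+x. ennreal (P x) \<partial>M) \<le> 1" and G1: "(\<integral>\<^sup>+x. ennreal (G x) \<partial>M) = 1"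
  shows "(\<integral>\<^sup>+x. ennreal \<bar>P x - G x\<bar> \<partial>M) \<le> 2 * (\<integral>\<^sup>+x. ennreal (max 0 (G x - P x)) \<partial>M)"
proof -
  have "1 + (\<integral>\<^sup>+x. ennreal \<bar>P x - G x\<bar> \<partial>M) = (\<integral>\<^sup>+x. ennreal (G x + \<bar>P x - G x\<bar>) \<partial>M)"
    using G0 by (subst G1[symmetric]) (simp add: nn_integral_add[symmetric])
  also have "\<dots> = (\<integral>\<^sup>+x. ennreal (P x) + 2 * ennreal (max 0 (G x - P x)) \<partial>M)"
  proof (intro nn_integral_cong)
    fix x
    have "ennreal (P x) + 2 * ennreal (max 0 (G x - P x)) = ennreal (P x + 2 * max 0 (G x - P x))"
      using P0[of x] by (simp add: ennreal_mult)
    also have "P x + 2 * max 0 (G x - P x) = G x + \<bar>P x - G x\<bar>"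
      by (simp add: max_def)
    finally show "ennreal (G x + \<bar>P x - G x\<bar>) = ennreal (P x) + 2 * ennreal (max 0 (G x - P x))"
      by simp
  qed
  also have "\<dots> = (\<integral>\<^sup>+x. ennreal (P x) \<partial>M) + 2 * (\<integral>\<^sup>+x. ennreal (max 0 (G x - P x)) \<partial>M)"
    by (simp add: nn_integral_add nn_integral_cmult)
  also have "\<dots> \<le> 1 + 2 * (\<integral>\<^sup>+x. ennreal (max 0 (G x - P x)) \<partial>M)"
    using P1 by (intro add_right_mono)
  finally show ?thesis
    unfolding ennreal_add_left_cancel_le by simp
qed

lemma nn_integral_indicator_le_sqrt:
  fixes f :: "'a \<Rightarrow> real"
  assumes [measurable]: "f \<in> borel_measurable M" "B \<in> sets M"
    and I: "(\<integral>\<^sup>+x. ennreal ((f x)\<^sup>2) \<partial>M) = ennreal (d\<^sup>2)" "0 \<le> d"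
    and V: "emeasure M B = ennreal (v\<^sup>2)" "0 \<le> v"
  shows "(\<integral>\<^sup>+x. ennreal \<bar>f x\<bar> * indicator B x \<partial>M) \<le> ennreal (d * v)"
proof -
  have "(\<integral>\<^sup>+x. ennreal \<bar>f x\<bar> * indicator B x \<partial>M)\<^sup>2 \<le>
      (\<integral>\<^sup>+x. (ennreal \<bar>f x\<bar>)\<^sup>2 \<partial>M) * (\<integral>\<^sup>+x. (indicator B x)\<^sup>2 \<partial>M)"
    by (rule Cauchy_Schwarz_nn_integral) auto
  also have "(\<integral>\<^sup>+x. (ennreal \<bar>f x\<bar>)\<^sup>2 \<partial>M) = ennreal (d\<^sup>2)"
    by (simp add: ennreal_power I(1))
  also have "(\<integral>\<^sup>+x. (indicator B x)\<^sup>2 \<partial>M) = (\<integral>\<^sup>+x. indicator B x \<partial>M)"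
    by (intro nn_integral_cong) (auto simp: indicator_def)
  also have "\<dots> = ennreal (v\<^sup>2)"
    using V by simp
  finally have "(\<integral>\<^sup>+x. ennreal \<bar>f x\<bar> * indicator B x \<partial>M)\<^sup>2 \<le> (ennreal (d * v))\<^sup>2"
    using I(2) V(2) by (simp add: ennreal_mult[symmetric] ennreal_power power_mult_distrib)
  \<comment> \<open>The squared bound forces the integral to be finite, so the square root can be
    taken among the reals.\<close>
  moreover obtain r where "(\<integral>\<^sup>+x. ennreal \<bar>f x\<bar> * indicator B x \<partial>M) = ennreal r" "0 \<le> r"
    using calculation I(2) V(2)
    by (cases "\<integral>\<^sup>+x. ennreal \<bar>f x\<bar> * indicator B x \<partial>M")
      (auto simp: power2_eq_square top_unique ennreal_top_mult ennreal_mult_eq_top_iff)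
  ultimately have "ennreal (r\<^sup>2) \<le> ennreal ((d * v)\<^sup>2)"
    using I(2) V(2) by (simp add: ennreal_power)
  then have "r \<le> d * v"
    using I(2) V(2) by (intro power2_le_imp_le[of r "d * v"]) (auto simp: ennreal_le_iff)
  then show ?thesis
    using \<open>_ = ennreal r\<close> by (simp add: ennreal_leI)
qed

section \<open>Gaussian integrals and the volume of the cube\<close>

lemma gaussm_eq_prod: "gaussm m x = (\<Prod>k\<in>{1..m}. std_normal_density (x k))"
proof -
  have "(\<Prod>k\<in>{1..m}. std_normal_density (x k)) = (1 / sqrt (2 * pi)) ^ m * exp (\<Sum>k\<in>{1..m}. - (x k)\<^sup>2 / 2)"
    unfolding std_normal_density_def prod.distrib by (simp add: exp_sum)
  also have "(\<Sum>k\<in>{1..m}. - (x k)\<^sup>2 / 2) = - (\<Sum>k\<in>{1..m}. (x k)\<^sup>2) / 2"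
    by (simp add: sum_divide_distrib sum_negf)
  also have "(1 / sqrt (2 * pi)) ^ m = (2 * pi) powr (- real m / 2)"
  proof -
    have "(1 / sqrt (2 * pi)) ^ m = ((2 * pi) powr (- 1 / 2)) powr real m"
      by (simp add: powr_realpow powr_minus_divide powr_half_sqrt flip: powr_half_sqrt)
    then show ?thesis
      by (simp add: powr_powr)
  qed
  finally show ?thesis
    by (simp add: gaussm_def)
qed

lemma nn_integral_prod_normal_density:
  assumes "0 < \<sigma>"
  shows "(\<integral>\<^sup>+x. ennreal (\<Prod>k\<in>{1..m}. normal_density \<mu> \<sigma> (x k)) \<partial>lebesgue_m m) = 1"
proof -
  interpret product_sigma_finite "\<lambda>_::nat. lborel :: real measure"
    by unfold_locales
  interpret prob_space "density lborel (normal_density \<mu> \<sigma>)"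
    by (rule prob_space_normal_density[OF assms])
  have "(\<integral>\<^sup>+x. ennreal (normal_density \<mu> \<sigma> x) \<partial>lborel) = 1"
    using emeasure_space_1 by (simp add: emeasure_density)
  then show ?thesis
    unfolding lebesgue_m_def
    by (subst prod_ennreal[symmetric], simp, subst product_nn_integral_prod) auto
qed

lemma gaussm_measurable [measurable]: "gaussm m \<in> borel_measurable (lebesgue_m m)"
  unfolding gaussm_eq_prod[abs_def] lebesgue_m_def by measurable

lemma nn_integral_gaussm: "(\<integral>\<^sup>+x. ennreal (gaussm m x) \<partial>lebesgue_m m) = 1"
  unfolding gaussm_eq_prod by (rule nn_integral_prod_normal_density) simp

lemma emeasure_lebesgue_m_cube:
  assumes "0 \<le> R"
  shows "emeasure (lebesgue_m m) (Pi\<^sub>E {1..m} (\<lambda>_. {-R..R})) = ennreal ((2 * R) ^ m)"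
proof -
  interpret product_sigma_finite "\<lambda>_::nat. lborel :: real measure"
    by unfold_locales
  show ?thesis
    unfolding lebesgue_m_def using assms
    by (subst emeasure_PiM) (auto simp: prod_ennreal ennreal_power)
qed

text \<open>Half of the exponent is bounded by exp(-R^2/4), because some coordinate exceeds R in
  absolute value outside the cube. The other half is kept as a Gaussian of variance 2, which has
  mass 1; the ratio of normalizing constants is 2^(m/2).\<close>

lemma gaussm_tail:
  assumes "0 \<le> R"
  shows "(\<integral>\<^sup>+x. ennreal (gaussm m x) * indicator (space (lebesgue_m m) - Pi\<^sub>E {1..m} (\<lambda>_. {-R..R})) x \<partial>lebesgue_m m)
    \<le> ennreal (2 powr (real m / 2) * exp (- R\<^sup>2 / 4))"
proof -
  let ?c = "2 powr (real m / 2) * exp (- R\<^sup>2 / 4)"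
  let ?g = "\<lambda>x. \<Prod>k\<in>{1..m}. normal_density 0 (sqrt 2) (x k)"
  have gauss: "gaussm m x = 2 powr (real m / 2) * exp (- (\<Sum>k\<in>{1..m}. (x k)\<^sup>2) / 4) * ?g x" for x
  proof -
    have "std_normal_density y = sqrt 2 * exp (- y\<^sup>2 / 4) * normal_density 0 (sqrt 2) y" for y
      by (simp add: normal_density_def real_sqrt_mult exp_add[symmetric] field_simps)
    then have "gaussm m x = sqrt 2 ^ m * exp (\<Sum>k\<in>{1..m}. - (x k)\<^sup>2 / 4) * ?g x"
      unfolding gaussm_eq_prod by (simp add: prod.distrib exp_sum)
    moreover have "sqrt 2 ^ m = (2::real) powr (real m / 2)"
      by (simp add: powr_half_sqrt[symmetric] powr_powr powr_realpow[symmetric])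
    moreover have "(\<Sum>k\<in>{1..m}. - (x k)\<^sup>2 / 4) = - (\<Sum>k\<in>{1..m}. (x k)\<^sup>2) / 4"
      by (simp add: sum_divide_distrib sum_negf)
    ultimately show ?thesis
      by simp
  qed
  have g0: "0 \<le> ?g x" for x
    by (simp add: prod_nonneg)
  have "(\<integral>\<^sup>+x. ennreal (gaussm m x) * indicator (space (lebesgue_m m) - Pi\<^sub>E {1..m} (\<lambda>_. {-R..R})) x \<partial>lebesgue_m m)
      \<le> (\<integral>\<^sup>+x. ennreal ?c * ennreal (?g x) \<partial>lebesgue_m m)"
  proof (intro nn_integral_mono)
    fix x assume x: "x \<in> space (lebesgue_m m)"
    show "ennreal (gaussm m x) * indicator (space (lebesgue_m m) - Pi\<^sub>E {1..m} (\<lambda>_. {-R..R})) x \<le> ennreal ?c * ennreal (?g x)"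
    proof (cases "x \<in> Pi\<^sub>E {1..m} (\<lambda>_. {-R..R})")
      case False
      then obtain k where k: "k \<in> {1..m}" "x k \<notin> {-R..R}"
        using x by (auto simp: lebesgue_m_def space_PiM PiE_iff)
      have "R\<^sup>2 \<le> (x k)\<^sup>2"
        using k(2) assms by (intro abs_le_square_iff[THEN iffD1]) auto
      also have "\<dots> \<le> (\<Sum>k\<in>{1..m}. (x k)\<^sup>2)"
        using k(1) by (intro member_le_sum) auto
      finally have "gaussm m x \<le> ?c * ?g x"
        unfolding gauss using g0 by (intro mult_right_mono mult_left_mono) auto
      then show ?thesis
        using False x g0[of x] by (auto simp add: ennreal_mult[symmetric] intro!: ennreal_leI)
    qed auto
  qed
  also have "\<dots> = ennreal ?c * (\<integral>\<^sup>+x. ennreal (?g x) \<partial>lebesgue_m m)"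
    by (rule nn_integral_cmult) (simp add: lebesgue_m_def)
  also have "\<dots> = ennreal ?c"
    by (subst nn_integral_prod_normal_density) simp_all
  finally show ?thesis .
qed

section \<open>Joining cube and tail, and the numerical constants\<close>

lemma densX_measurable [measurable]: "densX a b n m \<in> borel_measurable (lebesgue_m m)"
  unfolding densX_def[abs_def] by measurable

lemma Delta2_sq:
  assumes "Delta2 a b n m \<noteq> \<infinity>"
  shows "(\<integral>\<^sup>+x. ennreal ((densX a b n m x - gaussm m x)\<^sup>2) \<partial>lebesgue_m m) =
    ennreal ((enn2real (Delta2 a b n m))\<^sup>2)"
  using assms by (auto simp: Delta2_def Let_def less_top split: if_splits)

lemma Delta1_le_cube:
  assumes mass: "(\<integral>\<^sup>+x. ennreal (densX a b n m x) \<partial>lebesgue_m m) \<le> 1"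
    and fin: "Delta2 a b n m \<noteq> \<infinity>" and R: "0 < R"
  shows "Delta1 a b n m \<le> ennreal (2 * (enn2real (Delta2 a b n m) * (2 * R) powr (real m / 2)
    + 2 powr (real m / 2) * exp (- R\<^sup>2 / 4)))"
proof -
  let ?B = "Pi\<^sub>E {1..m} (\<lambda>_. {-R..R})" and ?M = "lebesgue_m m"
  let ?P = "densX a b n m" and ?G = "gaussm m"
  let ?d = "enn2real (Delta2 a b n m)"
  let ?v = "(2 * R) powr (real m / 2)"
  have B [measurable]: "?B \<in> sets ?M"
    unfolding lebesgue_m_def by (intro sets_PiM_I_finite) auto
  have P0: "0 \<le> ?P x" for x
    by (simp add: densX_def)
  have G0: "0 \<le> ?G x" for x
    by (simp add: gaussm_def)
  have "?v\<^sup>2 = (2 * R) ^ m"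
    using R by (simp add: power2_eq_square powr_add[symmetric] powr_realpow)
  then have V: "emeasure ?M ?B = ennreal (?v\<^sup>2)"
    using R by (simp only: emeasure_lebesgue_m_cube less_imp_le)
  have "(\<integral>\<^sup>+x. ennreal (max 0 (?G x - ?P x)) \<partial>?M) \<le>
      (\<integral>\<^sup>+x. ennreal \<bar>?P x - ?G x\<bar> * indicator ?B x + ennreal (?G x) * indicator (space ?M - ?B) x \<partial>?M)"
  \<comment> \<open>Outside the cube (G - P)^+ is at most G because P is nonnegative.\<close>
  proof (intro nn_integral_mono)
    fix x assume "x \<in> space ?M"
    then show "ennreal (max 0 (?G x - ?P x)) \<le>
        ennreal \<bar>?P x - ?G x\<bar> * indicator ?B x + ennreal (?G x) * indicator (space ?M - ?B) x"
      using P0[of x] G0[of x] by (cases "x \<in> ?B") (auto intro!: ennreal_leI)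
  qed
  also have "\<dots> = (\<integral>\<^sup>+x. ennreal \<bar>?P x - ?G x\<bar> * indicator ?B x \<partial>?M) +
      (\<integral>\<^sup>+x. ennreal (?G x) * indicator (space ?M - ?B) x \<partial>?M)"
    by (rule nn_integral_add) measurable
  also have "\<dots> \<le> ennreal (?d * ?v) + ennreal (2 powr (real m / 2) * exp (- R\<^sup>2 / 4))"
    using R Delta2_sq[OF fin] V B
    by (intro add_mono gaussm_tail nn_integral_indicator_le_sqrt) auto
  also have "\<dots> = ennreal (?d * ?v + 2 powr (real m / 2) * exp (- R\<^sup>2 / 4))"
    by simp
  finally have "2 * (\<integral>\<^sup>+x. ennreal (max 0 (?G x - ?P x)) \<partial>?M) \<le>
      2 * ennreal (?d * ?v + 2 powr (real m / 2) * exp (- R\<^sup>2 / 4))"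
    by (rule mult_left_mono) simp
  also have "\<dots> = ennreal (2 * (?d * ?v + 2 powr (real m / 2) * exp (- R\<^sup>2 / 4)))"
    by (subst ennreal_mult) auto
  finally show ?thesis
    using nn_integral_abs_diff_le_pos_part[OF _ _ P0 G0 mass nn_integral_gaussm]
    unfolding Delta1_def by (auto intro: order_trans)
qed

text \<open>Each z in [0, s], where s = x + y, satisfies z^p <= z s^(p-1); adding the cases z = x
  and z = y gives s^p. With p = m/4 this merges the cube and tail terms.\<close>

lemma add_powr_le:
  fixes x y p :: real
  assumes "0 \<le> x" "0 \<le> y" "1 \<le> p"
  shows "x powr p + y powr p \<le> (x + y) powr p"
proof (cases "x + y = 0")
  case False
  define s where "s = x + y"
  have s: "0 < s"
    using assms False by (simp add: s_def)
  have *: "z powr p \<le> z * s powr (p - 1)" if "0 \<le> z" "z \<le> s" for z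
  proof (cases "z = 0")
    case False
    have "z powr p = z * z powr (p - 1)"
      using False that by (simp add: powr_diff)
    then show ?thesis
      using that assms(3) by (auto intro!: mult_left_mono powr_mono2)
  qed simp
  have "x powr p + y powr p \<le> (x + y) * s powr (p - 1)"
    using *[of x] *[of y] assms by (simp add: s_def distrib_right)
  also have "\<dots> = s powr p"
    using s by (simp add: s_def[symmetric] powr_diff)
  finally show ?thesis
    by (simp add: s_def)
qed (use assms in \<open>auto simp: add_nonneg_eq_0_iff\<close>)

lemma Delta1_le_Delta2:
  assumes mass: "(\<integral>\<^sup>+x. ennreal (densX a b n m x) \<partial>lebesgue_m m) \<le> 1"
    and small: "Delta2 a b n m \<le> ennreal (exp (- 1))" and m: "4 \<le> m" and c: "5 \<le> c"
  shows "Delta1 a b n m \<le> ennreal (2 * (c * m * ln (1 / enn2real (Delta2 a b n m))) powr (real m / 4)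
    * enn2real (Delta2 a b n m))"
proof -
  define d where "d = enn2real (Delta2 a b n m)"
  have fin: "Delta2 a b n m \<noteq> \<infinity>"
    using small by (auto simp: top_unique)
  have D: "Delta2 a b n m = ennreal d" and d0: "0 \<le> d"
    using fin by (auto simp: d_def less_top)
  show ?thesis
  proof (cases "d = 0")
    \<comment> \<open>Here the claimed bound is 0, so no radius can be chosen; instead the two
      densities agree almost everywhere.\<close>
    case True
    have "(\<integral>\<^sup>+x. ennreal ((densX a b n m x - gaussm m x)\<^sup>2) \<partial>lebesgue_m m) = 0"
      using Delta2_sq[OF fin] True by (simp add: d_def)
    then have "AE x in lebesgue_m m. densX a b n m x = gaussm m x"
      by (subst (asm) nn_integral_0_iff_AE) auto
    then have "Delta1 a b n m = 0"
      unfolding Delta1_def by (subst nn_integral_0_iff_AE) auto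
    then show ?thesis
      by simp
  next
    case False
    with d0 have d: "0 < d"
      by simp
    define L where "L = ln (1 / d)"
    have "d \<le> exp (- 1)"
      using small d0 unfolding D by (simp add: ennreal_le_iff)
    then have "ln d \<le> - 1"
      using d by (metis exp_le_cancel_iff exp_ln)
    then have L: "1 \<le> L"
      using d by (simp add: L_def ln_div)
    have eL: "exp (- L) = d"
      using d by (simp add: L_def ln_div)
    have "Delta1 a b n m \<le> ennreal (2 * (d * (2 * (2 * sqrt L)) powr (real m / 2)
        + 2 powr (real m / 2) * exp (- (2 * sqrt L)\<^sup>2 / 4)))"
      unfolding d_def using L by (intro Delta1_le_cube[OF mass fin]) auto
    also have "(2 * (2 * sqrt L)) powr (real m / 2) = (16 * L) powr (real m / 4)"
    proof -
      have "2 * (2 * sqrt L) = (16 * L) powr (1 / 2)"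
        using L by (simp add: powr_half_sqrt real_sqrt_mult)
      then show ?thesis
        by (simp add: powr_powr)
    qed
    also have "(2::real) powr (real m / 2) = 4 powr (real m / 4)"
    proof -
      have "(2::real) powr (real m / 2) = (2 powr 2) powr (real m / 4)"
        by (subst powr_powr) simp
      then show ?thesis
        by simp
    qed
    also have "exp (- (2 * sqrt L)\<^sup>2 / 4) = d"
      using L eL by (simp add: power_mult_distrib)
    also have "d * (16 * L) powr (real m / 4) + 4 powr (real m / 4) * d =
        ((16 * L) powr (real m / 4) + 4 powr (real m / 4)) * d"
      by (simp add: algebra_simps)
    also have "ennreal (2 * (((16 * L) powr (real m / 4) + 4 powr (real m / 4)) * d)) \<le>
        ennreal (2 * ((c * m * L) powr (real m / 4) * d))"
    proof (intro ennreal_leI mult_left_mono mult_right_mono)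
      \<comment> \<open>The 16 L comes from R = 2 sqrt L, since 2R = (16 L)^(1/2). The tail's 4 is
        at most 4 L, and 20 <= c m because c >= 5 and m >= 4.\<close>
      have "(16 * L) powr (real m / 4) + 4 powr (real m / 4) \<le> (16 * L + 4) powr (real m / 4)"
        using L m by (intro add_powr_le) auto
      also have "\<dots> \<le> (c * m * L) powr (real m / 4)"
      proof (intro powr_mono2)
        have "5 * 4 \<le> c * real m"
          using c m by (intro mult_mono) auto
        then have "20 * L \<le> c * m * L"
          using L by (intro mult_right_mono) auto
        then show "16 * L + 4 \<le> c * m * L"
          using L by linarith
      qed (use L in auto)
      finally show "(16 * L) powr (real m / 4) + 4 powr (real m / 4) \<le> (c * m * L) powr (real m / 4)" .
    qed (use d0 in auto)
    finally show ?thesis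
      by (simp add: d_def L_def mult.assoc)
  qed
qed

text \<open>This brings both thresholds of the theorem below 1/e. The base is at least 1, so m >= 4
  allows replacing the exponent by -2; squaring the base yields 4 k e m^2, and its factor e supplies
  the 1/e.\<close>

lemma threshold_le:
  fixes c k :: real and m :: nat
  assumes m: "4 \<le> m" and c: "1 \<le> c" and k: "c \<le> k"
  shows "c * m * (2 * sqrt (k * exp 1) * m) powr (- real m / 2) \<le> exp (- 1)"
proof -
  let ?y = "2 * sqrt (k * exp 1) * m"
  have "1 * 1 \<le> k * exp 1"
    using k c by (intro mult_mono) auto
  then have "1 \<le> sqrt (k * exp 1)"
    by simp
  then have "1 * 1 \<le> (2 * sqrt (k * exp 1)) * m"
    using m by (intro mult_mono) linarith+
  then have y: "1 \<le> ?y"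
    by simp
  have "?y powr (- real m / 2) \<le> ?y powr (- 2)"
    using y m by (intro powr_mono) auto
  also have "\<dots> = 1 / (4 * k * exp 1 * m\<^sup>2)"
    using y k c by (simp add: powr_minus divide_simps power_mult_distrib)
  finally have "c * m * ?y powr (- real m / 2) \<le> c * m * (1 / (4 * k * exp 1 * m\<^sup>2))"
    using c by (intro mult_left_mono) auto
  also have "\<dots> = (c / k) * (1 / (4 * m)) * exp (- 1)"
    using k c m by (simp add: divide_simps exp_minus power2_eq_square)
  also have "\<dots> \<le> 1 * 1 * exp (- 1)"
    using k c m by (intro mult_mono) auto
  finally show ?thesis
    by simp
qed

theorem theorem0p2:
  fixes a b :: real and n m :: nat
  assumes "a \<in> {-1/2, 1/2}" and "b \<in> {-1/2, 1/2}" and "m \<ge> 4"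
  shows "(n \<ge> m^4 \<and> Delta2 a b n m \<le> ennreal (3 * m * (2 * sqrt (3 * exp 1) * m) powr (- real m / 2))
           \<longrightarrow> Delta1 a b n m \<le> ennreal (2 * (48 * m * ln (1 / enn2real (Delta2 a b n m))) powr (real m / 4)
                                         * enn2real (Delta2 a b n m)))
       \<and> (n \<ge> m^3 \<and> Delta2 a b n m \<le> ennreal (2.5 * m * (2 * sqrt (5 * exp 1) * m) powr (- real m / 2))
           \<longrightarrow> Delta1 a b n m \<le> ennreal (2 * (80 * m * ln (1 / enn2real (Delta2 a b n m))) powr (real m / 4)
                                         * enn2real (Delta2 a b n m)))"
proof -
  have *: "Delta1 a b n m \<le> ennreal (2 * (k * m * ln (1 / enn2real (Delta2 a b n m))) powr (real m / 4)
      * enn2real (Delta2 a b n m))"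
    if "Delta2 a b n m \<le> ennreal (c * m * (2 * sqrt (c' * exp 1) * m) powr (- real m / 2))"
      and "1 \<le> c" "c \<le> c'" "5 \<le> k" for c c' k :: real
  proof (rule Delta1_le_Delta2[OF nn_integral_densX_le_1[OF assms(1,2)] _ assms(3) \<open>5 \<le> k\<close>])
    show "Delta2 a b n m \<le> ennreal (exp (- 1))"
      using that(1) threshold_le[OF assms(3) that(2,3)] by (meson ennreal_leI order_trans)
  qed
  show ?thesis
    unfolding of_nat_mult of_nat_numeral
    by (intro conjI impI *[of 3 3 48] *[of "2.5" 5 80]) (erule conjunct2, simp_all)
qed

end
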